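(* For every integer $m\ge 1$, $$ \zeta(4m-1) = -\frac{F_{2m-1}\,4^{4m-2}}{D_m}\, S_{4m-1}(1) + \frac{G_{2m-1}\,4^{2m-1}}{D_m}\, S_{4m-1}(2) - \frac{F_{2m-1}\,4^{2m-1}}{D_m}\, S_{4m-1}(4). $$
   Context: $\zeta$ is the Riemann zeta function. For a positive integer $n$ and real $r>0$, $S_n(r)=\sum_{k=1}^{\infty}\frac{1}{k^n(e^{\pi r k}-1)}$. The Bernoulli numbers $B_k$ are defined by $\frac{x}{e^x-1}=\sum_{n=0}^\infty \frac{B_n x^n}{n!}$ for $|x|<2\pi$. For a nonnegative integer $n$, $$F_n=\sum_{k=0}^{n+1}(-1)^k\frac{B_{2k}B_{2n+2-2k}}{(2k)!(2n+2-2k)!},\qquad G_n=\sum_{k=0}^{n+1}(-4)^k\frac{B_{2k}B_{2n+2-2k}}{(2k)!(2n+2-2k)!}.$$ For an integer $m\ge 1$, $$D_m=\frac{4^{2m-1}\big[(4^{2m-1}+1)F_{2m-1}-G_{2m-1}\big]}{2}.$$ *)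

theory Defs
  imports "HOL-Complex_Analysis.Complex_Analysis"
begin

text \<open>
  The Dirichlet series of the Riemann zeta function. It converges, and hence defines the
  zeta function, for \<open>Re s > 1\<close> only; the analytic continuation is not modelled,
  so values outside this half-plane are meaningless.
\<close>
definition zeta :: "complex \<Rightarrow> complex" where
  "zeta s = (\<Sum>k. 1 / of_nat (Suc k) powr s)"

definition S_series :: "nat \<Rightarrow> real \<Rightarrow> real" where
  "S_series n r = (\<Sum>k. 1 / (real (Suc k) ^ n * (exp (pi * r * real (Suc k)) - 1)))"

text \<open>
  The generating function \<open>x / (e\<^sup>x - 1)\<close> is taken as a formal power series; the quotient
  exists because numerator and denominator both have subdegree 1.
  Lemma \<open>bernoulli_sums\<close> below is the defining analytic identity.
\<close>
definition bernoulli :: "nat \<Rightarrow> real" where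
  "bernoulli n = fact n * fps_nth (fps_X / (fps_exp 1 - 1)) n"

definition F_num :: "nat \<Rightarrow> real" where
  "F_num n = (\<Sum>k=0..n+1. (-1) ^ k *
     (bernoulli (2*k) * bernoulli (2*n+2-2*k) / (fact (2*k) * fact (2*n+2-2*k))))"

definition G_num :: "nat \<Rightarrow> real" where
  "G_num n = (\<Sum>k=0..n+1. (-4) ^ k *
     (bernoulli (2*k) * bernoulli (2*n+2-2*k) / (fact (2*k) * fact (2*n+2-2*k))))"

definition D_num :: "nat \<Rightarrow> real" where
  "D_num m = 4 ^ (2*m-1) * ((4 ^ (2*m-1) + 1) * F_num (2*m-1) - G_num (2*m-1)) / 2"

lemma bernoulli_sums:
  fixes x :: complex
  assumes "norm x < 2 * pi" "x \<noteq> 0"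
  shows "(\<lambda>n. of_real (bernoulli n) * x ^ n / fact n) sums (x / (exp x - 1))"
proof -
  define A :: "real fps" where "A = fps_X / (fps_exp 1 - 1)"
  define B :: "complex fps" where "B = fps_X / (fps_exp 1 - 1)"
  have sub_real: "subdegree (fps_exp (1::real) - 1) = 1"
    by (intro subdegreeI) auto
  have sub_complex: "subdegree (fps_exp (1::complex) - 1) = 1"
    by (intro subdegreeI) auto
  have sub_complex': "subdegree (1 - fps_exp (1::complex)) = 1"
    by (intro subdegreeI) auto
  have "(fps_exp (1::real) - 1) dvd fps_X"
    using sub_real by (subst fps_dvd_iff) auto
  hence A: "A * (fps_exp 1 - 1) = fps_X"
    unfolding A_def by (rule dvd_div_mult_self)
  have nz: "fps_exp (1::complex) - 1 \<noteq> 0"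
    using sub_complex by auto
  define A' where "A' = Abs_fps (\<lambda>n. complex_of_real (fps_nth A n))"
  have "A' * (fps_exp 1 - 1) = fps_X"
  proof (rule fps_ext)
    fix n
    have "fps_nth (A' * (fps_exp 1 - 1)) n = of_real (fps_nth (A * (fps_exp 1 - 1)) n)"
      by (auto simp: fps_mult_nth A'_def intro!: sum.cong)
    thus "fps_nth (A' * (fps_exp 1 - 1)) n = fps_nth fps_X n"
      by (simp add: A fps_X_def)
  qed
  hence "B = A'"
    unfolding B_def using nz by (metis nonzero_mult_div_cancel_right)
  hence coeff: "of_real (bernoulli n) = (fact n * fps_nth B n :: complex)" for n
    by (simp add: bernoulli_def A'_def A_def)

  have nz_exp: "eval_fps (fps_exp 1 - 1) z \<noteq> 0"
    if "z \<in> eball 0 (ereal (2 * pi))" "z \<noteq> 0" for z :: complex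
  proof
    assume "eval_fps (fps_exp 1 - 1) z = 0"
    hence "exp z = 1" by (simp add: eval_fps_diff)
    then obtain n :: int where n: "Re z = 0" "Im z = of_int (2 * n) * pi"
      by (auto simp: exp_eq_1)
    hence "norm z = 2 * pi * \<bar>of_int n\<bar>"
      by (simp add: cmod_def abs_mult)
    moreover have "norm z < 2 * pi" using that by (simp add: in_eball_iff)
    ultimately have "\<bar>real_of_int n\<bar> < 1"
      using pi_gt_zero by (simp add: mult_less_cancel_left1)
    hence "n = 0" by linarith
    thus False using n \<open>z \<noteq> 0\<close> by (simp add: complex_eq_iff)
  qed
  have radius: "fps_conv_radius (fps_exp (1::complex) - 1) = \<infinity>"
    using fps_conv_radius_diff[of "fps_exp (1::complex)" 1] by simp
  have conv: "fps_conv_radius B \<ge> ereal (2 * pi)"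
    and eval: "eval_fps B x = x / (exp x - 1)"
    using fps_conv_radius_divide[of "fps_exp 1 - 1" fps_X "ereal (2 * pi)"]
      eval_fps_divide[of "fps_exp 1 - 1" fps_X "ereal (2 * pi)" x] nz_exp assms
    by (simp_all add: B_def sub_complex sub_complex' radius eval_fps_diff)
  have "(\<lambda>n. fps_nth B n * x ^ n) sums eval_fps B x"
    using assms(1) by (intro sums_eval_fps less_le_trans[OF _ conv]) simp
  thus ?thesis
    by (simp add: coeff eval)
qed

end

theory Submission
  imports Defs
begin

text \<open>
  The values at \<open>r = 1\<close> and \<open>r = 2\<close> of Ramanujan's formula for \<open>\<zeta>(2n+1)\<close>, \<open>n\<close> odd, express
  \<open>F\<^sub>n\<close> and \<open>G\<^sub>n\<close> through \<open>\<zeta>(2n+1)\<close> and \<open>S\<^bsub>2n+1\<^esub>\<close> at 1, 2 and 4; eliminating the powers of \<open>\<pi>\<close>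
  gives the theorem, and the positivity of \<open>4\<^sup>n (S(1) - S(2)) + S(4) - S(2)\<close> shows that
  \<open>D\<^sub>m\<close> does not vanish.

  Ramanujan's formula itself follows without contour integration: by the partial fraction expansion
  of \<open>coth\<close>, the sum \<open>\<zeta>(2n+1)/2 + S(2r)\<close> is, up to a multiple of \<open>\<zeta>(2n+2)\<close>, the double series of
  \<open>1 / (k\<^bsup>2n\<^esup> (r\<^sup>2k\<^sup>2 + j\<^sup>2))\<close>, and repeated use of
  \<open>1 / (k\<^sup>2 (r\<^sup>2k\<^sup>2 + j\<^sup>2)) = 1 / (k\<^sup>2j\<^sup>2) - r\<^sup>2 / (j\<^sup>2 (r\<^sup>2k\<^sup>2 + j\<^sup>2))\<close>
  moves all powers of \<open>k\<close> to \<open>j\<close>, at the cost of products of even zeta values.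
\<close>

section \<open>The partial fraction expansion of the hyperbolic cotangent\<close>

text \<open>Differentiates both sides of the reflection formula
  \<open>rGamma z * rGamma (1 - z) = sin (pi z) / pi\<close>. The product rule reproduces the
  function itself times the Digamma difference, and \<open>sin (pi z)\<close> can be cancelled
  because \<open>z\<close> is not an integer.\<close>

lemma Digamma_reflection_complex:
  fixes z :: complex
  assumes "z \<notin> \<int>"
  shows "Digamma (1 - z) - Digamma z = of_real pi * cot (of_real pi * z)"
proof -
  have nonpos: "z \<notin> \<int>\<^sub>\<le>\<^sub>0" "1 - z \<notin> \<int>\<^sub>\<le>\<^sub>0"
  proof -
    show "z \<notin> \<int>\<^sub>\<le>\<^sub>0" using assms nonpos_Ints_Int by blast
    show "1 - z \<notin> \<int>\<^sub>\<le>\<^sub>0"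
    proof
      assume "1 - z \<in> \<int>\<^sub>\<le>\<^sub>0"
      hence "1 - (1 - z) \<in> \<int>" using nonpos_Ints_Int by (intro Ints_diff) auto
      thus False using assms by simp
    qed
  qed
  have sin_nz: "sin (of_real pi * z) \<noteq> 0"
    using assms by (auto simp: sin_eq_0 mult.commute)
  have "((\<lambda>z. rGamma z * rGamma (1 - z)) has_field_derivative
      (rGamma z * rGamma (1 - z) * (Digamma (1 - z) - Digamma z))) (at z)"
    using nonpos by (auto intro!: derivative_eq_intros simp: algebra_simps)
  also have "(\<lambda>z::complex. rGamma z * rGamma (1 - z)) = (\<lambda>z. sin (of_real pi * z) / of_real pi)"
    by (simp add: rGamma_reflection_complex)
  finally have D: "((\<lambda>z. sin (of_real pi * z) / of_real pi) has_field_derivative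
      (sin (of_real pi * z) / of_real pi * (Digamma (1 - z) - Digamma z))) (at z)"
    by (simp add: rGamma_reflection_complex)
  have "((\<lambda>z. sin (of_real pi * z) / of_real pi) has_field_derivative cos (of_real pi * z)) (at z)"
    by (auto intro!: derivative_eq_intros)
  from DERIV_unique[OF D this] show ?thesis
    using sin_nz by (simp add: cot_def field_simps)
qed

text \<open>The Digamma series at \<open>1 - z\<close> and \<open>1 + z\<close> are subtracted, so
  that the Euler constants and the terms \<open>inverse (of_nat (Suc k))\<close> cancel. The term
  \<open>1 / z\<close> comes from the recurrence of Digamma, which replaces \<open>1 + z\<close> by
  \<open>z\<close> before the reflection formula applies.\<close>

lemma cot_partial_fractions:
  fixes z :: complex
  assumes "z \<notin> \<int>"
  shows "(\<lambda>k. 2 * z / (z\<^sup>2 - of_nat (Suc k) ^ 2)) sums (of_real pi * cot (of_real pi * z) - 1 / z)"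
proof -
  have shift: "of_nat (Suc k) + w \<noteq> 0" if "w \<notin> \<int>" for k and w :: complex
  proof
    assume "of_nat (Suc k) + w = 0"
    hence "w = - of_nat (Suc k)" by (metis add_eq_0_iff)
    thus False using that by (metis Ints_minus Ints_of_nat)
  qed
  have z: "z \<noteq> 0" "1 - z \<noteq> 0" "1 + z \<noteq> 0" "- z \<notin> \<int>"
    using assms shift[of z 0] shift[of "- z" 0] by auto
  have *: "(\<lambda>k. inverse (of_nat (Suc k)) - inverse (w + of_nat k)) sums (Digamma w + euler_mascheroni)"
    if "w \<noteq> 0" for w :: complex
    using summable_Digamma[OF that] by (simp add: Digamma_def summable_sums)
  have "(\<lambda>k. inverse (1 + z + of_nat k) - inverse (1 - z + of_nat k)) sums (Digamma (1 - z) - Digamma (1 + z))"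
    using sums_diff[OF *[OF z(2)] *[OF z(3)]] by (simp add: algebra_simps)
  also have "(\<lambda>k. inverse (1 + z + of_nat k) - inverse (1 - z + of_nat k)) =
      (\<lambda>k. 2 * z / (z\<^sup>2 - of_nat (Suc k) ^ 2))"
  proof
    fix k
    have nz: "of_nat (Suc k) + z \<noteq> 0" "of_nat (Suc k) - z \<noteq> 0"
      using shift[OF assms, of k] shift[OF z(4), of k] by auto
    have "inverse (1 + z + of_nat k) - inverse (1 - z + of_nat k) =
        inverse (of_nat (Suc k) + z) - inverse (of_nat (Suc k) - z)"
      by (simp add: algebra_simps)
    also have "\<dots> = - 2 * z / ((of_nat (Suc k) + z) * (of_nat (Suc k) - z))"
      using nz by (simp add: divide_simps del: of_nat_Suc)
    also have "(of_nat (Suc k) + z) * (of_nat (Suc k) - z) = - (z\<^sup>2 - of_nat (Suc k) ^ 2)"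
      by (simp add: power2_eq_square algebra_simps)
    also have "- 2 * z / (- (z\<^sup>2 - of_nat (Suc k) ^ 2)) = 2 * z / (z\<^sup>2 - of_nat (Suc k) ^ 2)"
      by (simp only: mult_minus_left minus_divide_divide)
    finally show "inverse (1 + z + of_nat k) - inverse (1 - z + of_nat k) =
        2 * z / (z\<^sup>2 - of_nat (Suc k) ^ 2)" .
  qed
  also have "Digamma (1 - z) - Digamma (1 + z) = of_real pi * cot (of_real pi * z) - 1 / z"
    using Digamma_reflection_complex[OF assms] Digamma_plus1[OF z(1)] by (simp add: add.commute)
  finally show ?thesis .
qed

text \<open>The cotangent expansion at \<open>z = \<i> * y\<close>, multiplied by
  \<open>\<i>\<close>. Writing \<open>pi * coth (pi * y)\<close> through
  \<open>exp (2 * pi * y) - 1\<close> produces the denominators of \<open>S_series\<close>.\<close>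

lemma coth_partial_fractions:
  fixes y :: real
  assumes "y \<noteq> 0"
  shows "(\<lambda>k. 2 * y / (y\<^sup>2 + real (Suc k) ^ 2)) sums
           (pi + 2 * pi / (exp (2 * pi * y) - 1) - 1 / y)"
proof -
  define z where "z = \<i> * complex_of_real y"
  have z: "z \<notin> \<int>"
    using assms by (auto simp: z_def complex_eq_iff elim!: Ints_cases)
  define q where "q = complex_of_real (exp (2 * pi * y))"
  define p where "p = complex_of_real (exp (pi * y))"
  have p: "p \<noteq> 0" "q = p ^ 2"
    by (simp_all add: p_def q_def flip: of_real_power exp_of_nat_mult)
  have q: "q \<noteq> 1"
    using assms by (simp add: q_def)
  have "cot (of_real pi * z) = \<i> * (inverse p + p) / (inverse p - p)"
  proof -
    have 1: "exp (\<i> * (of_real pi * z)) = inverse p" "exp (- (\<i> * (of_real pi * z))) = p"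
      by (simp_all add: z_def p_def exp_of_real mult_ac exp_minus flip: exp_of_real)
    have "cos (of_real pi * z) = (inverse p + p) / 2" "sin (of_real pi * z) = - \<i> * (inverse p - p) / 2"
      unfolding cos_exp_eq sin_exp_eq 1 by simp_all
    thus ?thesis
      unfolding cot_def by (simp only:) (simp add: divide_simps)
  qed
  also have "\<dots> = - \<i> * (1 + 2 / (q - 1))"
    using p q by (simp add: divide_simps) (simp add: algebra_simps power2_eq_square)
  finally have cot: "cot (of_real pi * z) = - \<i> * (1 + 2 / (q - 1))" .
  have "(\<lambda>k. \<i> * (2 * z / (z\<^sup>2 - of_nat (Suc k) ^ 2))) sums
      (\<i> * (of_real pi * cot (of_real pi * z) - 1 / z))"
    by (intro sums_mult cot_partial_fractions z)
  also have "\<i> * (of_real pi * cot (of_real pi * z) - 1 / z) =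
      of_real (pi + 2 * pi / (exp (2 * pi * y) - 1) - 1 / y)"
    unfolding cot by (simp add: q_def z_def algebra_simps)
  also have "(\<lambda>k. \<i> * (2 * z / (z\<^sup>2 - of_nat (Suc k) ^ 2))) =
      (\<lambda>k. of_real (2 * y / (y\<^sup>2 + real (Suc k) ^ 2)))"
  proof
    fix k
    have "z\<^sup>2 - of_nat (Suc k) ^ 2 = - of_real (y\<^sup>2 + real (Suc k) ^ 2)"
      by (simp add: z_def power_mult_distrib)
    moreover have "\<i> * (2 * z) = - of_real (2 * y)"
      by (simp add: z_def)
    ultimately show "\<i> * (2 * z / (z\<^sup>2 - of_nat (Suc k) ^ 2)) = of_real (2 * y / (y\<^sup>2 + real (Suc k) ^ 2))"
      by (simp only: times_divide_eq_right minus_divide_divide of_real_divide)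
  qed
  finally show ?thesis
    unfolding sums_of_real_iff .
qed

section \<open>Zeta values at even integers\<close>

text \<open>A real-valued copy of the zeta series, so that convergence of its nonnegative terms
  gives \<open>has_sum\<close> directly; \<open>zeta_of_nat\<close> returns to the complex
  \<open>zeta\<close>.\<close>

definition zeta_nat :: "nat \<Rightarrow> real" where
  "zeta_nat s = (\<Sum>k. 1 / real (Suc k) ^ s)"

lemma zeta_nat_has_sum:
  assumes "s \<ge> 2"
  shows "((\<lambda>k. 1 / real (Suc k) ^ s) has_sum zeta_nat s) UNIV"
proof -
  have "summable (\<lambda>k. 1 / real (Suc k) ^ s)"
    using inverse_power_summable[OF assms, where 'a = real]
    by (subst summable_Suc_iff) (simp add: inverse_eq_divide)
  thus ?thesis
    unfolding zeta_nat_def by (intro sums_nonneg_imp_has_sum summable_sums) auto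
qed

lemma summable_on_product_nonneg:
  fixes f :: "'a \<Rightarrow> real" and g :: "'b \<Rightarrow> real"
  assumes "f summable_on A" "g summable_on B"
  assumes "\<And>x. x \<in> A \<Longrightarrow> f x \<ge> 0" "\<And>y. y \<in> B \<Longrightarrow> g y \<ge> 0"
  shows "(\<lambda>(x, y). f x * g y) summable_on A \<times> B"
proof (rule summable_on_SigmaI)
  show "((\<lambda>y. case (x, y) of (x, y) \<Rightarrow> f x * g y) has_sum f x * infsum g B) B" for x
    using assms(2) by (auto intro: has_sum_cmult_right)
  show "(\<lambda>x. f x * infsum g B) summable_on A"
    by (intro summable_on_cmult_left assms)
qed (use assms in auto)

text \<open>With \<open>x = y / (2 * pi)\<close>, each term of the hyperbolic cotangent expansion is
  a geometric series in \<open>x\<^sup>2 / (k+1)\<^sup>2\<close>. Summing the resulting double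
  series over \<open>i\<close> first gives the closed form, over \<open>k\<close> first the even
  zeta values.\<close>

lemma zeta_nat_generating_function:
  fixes y :: real
  assumes "y \<noteq> 0" "\<bar>y\<bar> < 2 * pi"
  shows "(\<lambda>i. 2 * (-1) ^ i * (zeta_nat (2 * i + 2) / (2 * pi) ^ (2 * i + 2)) * y ^ (2 * i + 2)) sums
           (y / (exp y - 1) + y / 2 - 1)"
proof -
  define x where "x = y / (2 * pi)"
  have x: "x \<noteq> 0" "\<bar>x\<bar> < 1" "2 * pi * x = y"
    using assms by (simp_all add: x_def)
  hence x2: "x\<^sup>2 < 1"
    by (simp add: abs_square_less_1)
  define g where "g = (\<lambda>(k, i). 2 * (-1) ^ i * (x\<^sup>2 / real (Suc k) ^ 2) ^ Suc i)"
  define L where "L = y / (exp y - 1) + y / 2 - 1"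
  have inner: "((\<lambda>i. g (k, i)) has_sum x * (2 * x / (x\<^sup>2 + real (Suc k) ^ 2))) UNIV" for k
  proof -
    define q where "q = x\<^sup>2 / real (Suc k) ^ 2"
    have q: "q \<ge> 0" "q < 1"
    proof -
      show "q \<ge> 0" by (simp add: q_def)
      have "x\<^sup>2 < real (Suc k) ^ 2"
        using x2 one_le_power[of "real (Suc k)" 2] by linarith
      thus "q < 1" by (simp add: q_def)
    qed
    have "summable (\<lambda>i. norm ((- q) ^ i))"
      using q by (simp add: norm_power summable_geometric)
    moreover have "(\<lambda>i. (- q) ^ i) sums (1 / (1 - (- q)))"
      using q by (intro geometric_sums) auto
    ultimately have "((\<lambda>i. (- q) ^ i) has_sum (1 / (1 + q))) UNIV"
      using norm_summable_imp_has_sum by fastforce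
    hence "((\<lambda>i. 2 * q * (- q) ^ i) has_sum (2 * q * (1 / (1 + q)))) UNIV"
      by (rule has_sum_cmult_right)
    also have "(\<lambda>i. 2 * q * (- q) ^ i) = (\<lambda>i. g (k, i))"
      by (simp add: g_def q_def power_minus[of q] fun_eq_iff power_minus[of "x\<^sup>2 / real (Suc k) ^ 2"] del: of_nat_Suc)
    also have "2 * q * (1 / (1 + q)) = x * (2 * x / (x\<^sup>2 + real (Suc k) ^ 2))"
    proof -
      have "1 + q \<noteq> 0" "x\<^sup>2 + real (Suc k) ^ 2 \<noteq> 0" using q by (auto simp: sum_power2_eq_zero_iff)
      thus ?thesis by (simp add: q_def divide_simps power2_eq_square del: of_nat_Suc)
    qed
    finally show ?thesis .
  qed
  have outer: "((\<lambda>k. x * (2 * x / (x\<^sup>2 + real (Suc k) ^ 2))) has_sum L) UNIV"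
  proof (rule sums_nonneg_imp_has_sum)
    have "(\<lambda>k. x * (2 * x / (x\<^sup>2 + real (Suc k) ^ 2))) sums
        (x * (pi + 2 * pi / (exp (2 * pi * x) - 1) - 1 / x))"
      by (intro sums_mult coth_partial_fractions x)
    also have "x * (pi + 2 * pi / (exp (2 * pi * x) - 1) - 1 / x) = L"
      using x by (simp add: L_def algebra_simps)
    finally show "(\<lambda>k. x * (2 * x / (x\<^sup>2 + real (Suc k) ^ 2))) sums L" .
  qed auto
  \<comment> \<open>A majorant of \<open>norm (g (k, i))\<close>, since \<open>(k+1)\<^sup>2\<close>
    is at most its own power with exponent \<open>i + 1\<close>. Absolute summability justifies the
    interchange.\<close>
  have "(\<lambda>(k, i). (1 / real (Suc k) ^ 2) * (2 * (x\<^sup>2) ^ Suc i)) summable_on UNIV \<times> UNIV"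
  proof (rule summable_on_product_nonneg)
    show "(\<lambda>k. 1 / real (Suc k) ^ 2) summable_on UNIV"
      using zeta_nat_has_sum[of 2] by (auto simp: summable_on_def)
    have "summable (\<lambda>i. (x\<^sup>2) ^ i)"
      using x2 by (intro summable_geometric) auto
    hence "summable (\<lambda>i. 2 * (x\<^sup>2) ^ Suc i)"
      by (intro summable_mult) (simp add: summable_mult)
    thus "(\<lambda>i. 2 * (x\<^sup>2) ^ Suc i) summable_on UNIV"
      by (intro summable_nonneg_imp_summable_on) auto
  qed auto
  hence "(\<lambda>p. norm (g p)) summable_on UNIV \<times> UNIV"
  proof (rule summable_on_comparison_test)
    fix p :: "nat \<times> nat"
    obtain k i where p: "p = (k, i)" by force
    have "real (Suc k) ^ 2 \<le> (real (Suc k) ^ 2) ^ Suc i"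
      by (intro self_le_power one_le_power) auto
    hence "1 / (real (Suc k) ^ 2) ^ Suc i \<le> 1 / real (Suc k) ^ 2"
      by (intro divide_left_mono mult_pos_pos) auto
    hence "(2 * (x\<^sup>2) ^ Suc i) * (1 / (real (Suc k) ^ 2) ^ Suc i) \<le> (2 * (x\<^sup>2) ^ Suc i) * (1 / real (Suc k) ^ 2)"
      by (intro mult_left_mono) auto
    thus "norm (g p) \<le> (case p of (k, i) \<Rightarrow> (1 / real (Suc k) ^ 2) * (2 * (x\<^sup>2) ^ Suc i))"
      by (simp add: g_def p abs_mult power_abs power_divide power_mult_distrib mult_ac del: of_nat_Suc power_Suc)
  qed auto
  hence "g summable_on UNIV \<times> UNIV"
    by (rule abs_summable_summable)
  with inner outer have "(g has_sum L) (UNIV \<times> UNIV)"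
    by (intro has_sum_SigmaI) auto
  hence "((\<lambda>(i, k). g (k, i)) has_sum L) (UNIV \<times> UNIV)"
    by (subst (asm) has_sum_swap)
  moreover have "((\<lambda>k. case (i, k) of (i, k) \<Rightarrow> g (k, i)) has_sum
      (2 * (-1) ^ i * (x\<^sup>2) ^ Suc i * zeta_nat (2 * i + 2))) UNIV" for i
  proof -
    have "((\<lambda>k. 2 * (-1) ^ i * (x\<^sup>2) ^ Suc i * (1 / real (Suc k) ^ (2 * i + 2))) has_sum
      (2 * (-1) ^ i * (x\<^sup>2) ^ Suc i * zeta_nat (2 * i + 2))) UNIV"
      by (intro has_sum_cmult_right zeta_nat_has_sum) auto
    also have "(\<lambda>k. 2 * (-1) ^ i * (x\<^sup>2) ^ Suc i * (1 / real (Suc k) ^ (2 * i + 2))) =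
        (\<lambda>k. case (i, k) of (i, k) \<Rightarrow> g (k, i))"
    proof
      fix k
      have "2 * i + 2 = 2 * Suc i" by simp
      hence "real (Suc k) ^ (2 * i + 2) = (real (Suc k) ^ 2) ^ Suc i"
        by (simp only: power_mult)
      thus "2 * (-1) ^ i * (x\<^sup>2) ^ Suc i * (1 / real (Suc k) ^ (2 * i + 2)) =
          (case (i, k) of (i, k) \<Rightarrow> g (k, i))"
        by (simp add: g_def power_divide del: of_nat_Suc power_Suc)
    qed
    finally show ?thesis .
  qed
  ultimately have "((\<lambda>i. 2 * (-1) ^ i * (x\<^sup>2) ^ Suc i * zeta_nat (2 * i + 2)) has_sum L) UNIV"
    by (rule has_sum_SigmaD)
  hence "(\<lambda>i. 2 * (-1) ^ i * (x\<^sup>2) ^ Suc i * zeta_nat (2 * i + 2)) sums L"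
    by (rule has_sum_imp_sums)
  also have "(\<lambda>i. 2 * (-1) ^ i * (x\<^sup>2) ^ Suc i * zeta_nat (2 * i + 2)) =
      (\<lambda>i. 2 * (-1) ^ i * (zeta_nat (2 * i + 2) / (2 * pi) ^ (2 * i + 2)) * y ^ (2 * i + 2))"
  proof
    fix i
    have "2 * i + 2 = 2 * Suc i" by simp
    hence "(x\<^sup>2) ^ Suc i = y ^ (2 * i + 2) / (2 * pi) ^ (2 * i + 2)"
      by (simp only: x_def power_divide power_mult)
    thus "2 * (-1) ^ i * (x\<^sup>2) ^ Suc i * zeta_nat (2 * i + 2) =
      2 * (-1) ^ i * (zeta_nat (2 * i + 2) / (2 * pi) ^ (2 * i + 2)) * y ^ (2 * i + 2)"
      by simp
  qed
  finally show ?thesis by (simp add: L_def)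
qed

lemma bernoulli_sums_real:
  fixes y :: real
  assumes "\<bar>y\<bar> < 2 * pi" "y \<noteq> 0"
  shows "(\<lambda>n. bernoulli n / fact n * y ^ n) sums (y / (exp y - 1))"
proof -
  have "(\<lambda>n. of_real (bernoulli n) * of_real y ^ n / fact n) sums
      (of_real y / (exp (of_real y) - 1 :: complex))"
    using assms by (intro bernoulli_sums) auto
  also have "of_real y / (exp (of_real y) - 1 :: complex) = of_real (y / (exp y - 1))"
    by (simp flip: exp_of_real)
  also have "(\<lambda>n. of_real (bernoulli n) * of_real y ^ n / fact n :: complex) =
      (\<lambda>n. of_real (bernoulli n / fact n * y ^ n))"
    by (simp add: fun_eq_iff)
  finally show ?thesis unfolding sums_of_real_iff .
qed

text \<open>Compares the coefficients of the first power of \<open>fps_X\<close> in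
  \<open>fps_X / E * E = fps_X\<close>, where \<open>E\<close> starts with
  \<open>fps_X\<close>.\<close>

lemma bernoulli_0: "bernoulli 0 = 1"
proof -
  define E where "E = fps_exp (1::real) - 1"
  have "subdegree E = 1"
    unfolding E_def by (intro subdegreeI) auto
  hence "fps_X / E * E = fps_X"
    by (intro dvd_div_mult_self) (subst fps_dvd_iff, auto)
  hence "fps_nth (fps_X / E * E) 1 = 1"
    by simp
  moreover have "fps_nth E 0 = 0" "fps_nth E 1 = 1"
    by (simp_all add: E_def)
  ultimately show ?thesis
    by (simp add: bernoulli_def fps_mult_nth E_def [symmetric])
qed

text \<open>The function \<open>y / (exp y - 1)\<close> has two power series expansions near 0, one
  with Bernoulli coefficients and one with even zeta values; their coefficients must agree.\<close>

theorem zeta_nat_even: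
  assumes "i \<ge> 1"
  shows "zeta_nat (2 * i) = (-1) ^ Suc i * (bernoulli (2 * i) / fact (2 * i)) * (2 * pi) ^ (2 * i) / 2"
proof -
  \<comment> \<open>The values at 0 and 1 come from moving \<open>y / 2 - 1\<close> to the other
    side of the generating function.\<close>
  define e where "e n = (if n = 0 then 1 else if n = 1 then - 1 / 2 else if even n then
      2 * (-1) ^ (n div 2 - 1) * (zeta_nat n / (2 * pi) ^ n) else 0)" for n
  \<comment> \<open>As \<open>0 / 0 = 0\<close>, both expansions are stated only for nonzero
    \<open>y\<close>. Taking \<open>d 0 = 0\<close>, which is the true difference because
    \<open>bernoulli 0 = e 0\<close>, settles the point \<open>y = 0\<close> directly.\<close>
  define d where "d n = (if n = 0 then 0 else bernoulli n / fact n - e n)" for n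
  have e_sums: "(\<lambda>n. e n * y ^ n) sums (y / (exp y - 1))" if "\<bar>y\<bar> < 2 * pi" "y \<noteq> 0" for y
  proof -
    have "(\<lambda>i. e (2 * i + 2) * y ^ (2 * i + 2)) sums (y / (exp y - 1) + y / 2 - 1)"
      using zeta_nat_generating_function[OF that(2,1)] by (simp add: e_def)
    \<comment> \<open>Coefficients 0 and 1 are masked because the zeta series reaches only the even
      indices from 2 on; a finite sum restores them afterwards.\<close>
    hence "(\<lambda>i. (if 2 * i + 2 \<in> {0,1} then 0 else e (2 * i + 2)) * y ^ (2 * i + 2)) sums
        (y / (exp y - 1) + y / 2 - 1)"
      by simp
    hence "(\<lambda>n. (if n \<in> {0,1} then 0 else e n) * y ^ n) sums (y / (exp y - 1) + y / 2 - 1)"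
    proof (subst (asm) sums_mono_reindex[where f = "\<lambda>n. (if n \<in> {0,1} then 0 else e n) * y ^ n"])
      show "(if n \<in> {0, 1} then 0 else e n) * y ^ n = 0" if "n \<notin> range (\<lambda>i. 2 * i + 2)" for n
      proof (cases "n \<in> {0, 1}")
        case False
        have "odd n"
        proof
          assume "even n"
          then obtain k where "n = 2 * k" by blast
          with False have "n = 2 * (k - 1) + 2" by auto
          with that show False by blast
        qed
        with False show ?thesis by (simp add: e_def)
      qed auto
    qed (auto simp: strict_mono_def)
    moreover have "(\<lambda>n. if n \<in> {0,1} then e n * y ^ n else 0) sums (\<Sum>n\<in>{0,1}. e n * y ^ n)"
      by (rule sums_If_finite_set) auto
    ultimately have "(\<lambda>n. (if n \<in> {0,1} then 0 else e n) * y ^ n + (if n \<in> {0,1} then e n * y ^ n else 0))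
        sums (y / (exp y - 1) + y / 2 - 1 + (\<Sum>n\<in>{0,1}. e n * y ^ n))"
      by (rule sums_add)
    also have "(\<lambda>n. (if n \<in> {0,1} then 0 else e n) * y ^ n + (if n \<in> {0,1} then e n * y ^ n else 0)) =
        (\<lambda>n. e n * y ^ n)"
      by auto
    also have "y / (exp y - 1) + y / 2 - 1 + (\<Sum>n\<in>{0,1}. e n * y ^ n) = y / (exp y - 1)"
      by (simp add: e_def)
    finally show ?thesis .
  qed
  have d_sums: "(\<lambda>n. d n * (y - 0) ^ n) sums 0" if "norm (y - 0) < 2 * pi" for y :: real
  proof (cases "y = 0")
    case True
    have "(\<lambda>n. d n * (y - 0) ^ n) = (\<lambda>_. 0)"
      using True by (auto simp: d_def)
    thus ?thesis by simp
  next
    case False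
    have "(\<lambda>n. bernoulli n / fact n * y ^ n - e n * y ^ n) sums (y / (exp y - 1) - y / (exp y - 1))"
      using that False by (intro sums_diff bernoulli_sums_real e_sums) auto
    also have "(\<lambda>n. bernoulli n / fact n * y ^ n - e n * y ^ n) = (\<lambda>n. d n * (y - 0) ^ n)"
      by (auto simp: d_def bernoulli_0 e_def algebra_simps)
    finally show ?thesis by simp
  qed
  have "d (2 * i) = 0"
  proof (rule ccontr)
    assume "d (2 * i) \<noteq> 0"
    \<comment> \<open>A power series with a nonzero higher coefficient has no zeros in some
      punctured ball around 0, but this one sums to 0 everywhere; the point \<open>s\<close> itself
      gives the contradiction.\<close>
    then obtain s where s: "s > 0" "\<And>z::real. z \<in> cball 0 s - {0} \<Longrightarrow> (0 :: real) \<noteq> 0"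
      using powser_0_nonzero[of "2 * pi" 0 d "\<lambda>_. 0" "2 * i"] d_sums assms by auto
    thus False using s(2)[of s] by auto
  qed
  hence "bernoulli (2 * i) / fact (2 * i) = 2 * (-1) ^ (i - 1) * (zeta_nat (2 * i) / (2 * pi) ^ (2 * i))"
    using assms by (simp add: d_def e_def)
  moreover obtain j where "i = Suc j"
    using assms by (cases i) auto
  ultimately show ?thesis
    by (cases "even j") simp_all
qed

section \<open>Ramanujan's formula\<close>

lemma has_sum_finite_sum:
  fixes f :: "'a \<Rightarrow> 'b \<Rightarrow> 'c :: topological_comm_monoid_add"
  assumes "\<And>i. i \<in> I \<Longrightarrow> (f i has_sum S i) A"
  shows "((\<lambda>x. \<Sum>i\<in>I. f i x) has_sum (\<Sum>i\<in>I. S i)) A"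
  using assms by (induction I rule: infinite_finite_induct) (auto intro: has_sum_add)

text \<open>Summation over \<open>j\<close> leads to \<open>S_series\<close>, while exchanging the
  roles of \<open>k\<close> and \<open>j\<close> replaces \<open>r\<close> by
  \<open>1 / r\<close>.\<close>

definition lattice_sum :: "nat \<Rightarrow> real \<Rightarrow> real" where
  "lattice_sum n r =
     (\<Sum>\<^sub>\<infinity>(k, j)\<in>UNIV \<times> UNIV. 1 / (real (Suc k) ^ (2 * n) * (r\<^sup>2 * real (Suc k) ^ 2 + real (Suc j) ^ 2)))"

text \<open>Dropping \<open>r\<^sup>2 * real (Suc k) ^ 2\<close> from the denominator leaves a
  product of two convergent zeta series as majorant.\<close>

lemma lattice_sum_has_sum:
  assumes "n \<ge> 1"
  shows "((\<lambda>(k, j). 1 / (real (Suc k) ^ (2 * n) * (r\<^sup>2 * real (Suc k) ^ 2 + real (Suc j) ^ 2)))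
           has_sum lattice_sum n r) (UNIV \<times> UNIV)"
  unfolding lattice_sum_def
proof (rule has_sum_infsum, rule summable_on_comparison_test)
  show "(\<lambda>(k, j). 1 / real (Suc k) ^ (2 * n) * (1 / real (Suc j) ^ 2)) summable_on UNIV \<times> UNIV"
    using zeta_nat_has_sum[of "2 * n"] zeta_nat_has_sum[of 2] assms
    by (intro summable_on_product_nonneg) (auto simp: summable_on_def)
next
  fix p :: "nat \<times> nat"
  obtain k j where p: "p = (k, j)" by force
  have "1 / (r\<^sup>2 * real (Suc k) ^ 2 + real (Suc j) ^ 2) \<le> 1 / real (Suc j) ^ 2"
    by (intro divide_left_mono mult_pos_pos add_nonneg_pos) auto
  hence "1 / real (Suc k) ^ (2 * n) * (1 / (r\<^sup>2 * real (Suc k) ^ 2 + real (Suc j) ^ 2)) \<le>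
      1 / real (Suc k) ^ (2 * n) * (1 / real (Suc j) ^ 2)"
    by (intro mult_left_mono) auto
  thus "(case p of (k, j) \<Rightarrow> 1 / (real (Suc k) ^ (2 * n) * (r\<^sup>2 * real (Suc k) ^ 2 + real (Suc j) ^ 2)))
      \<le> (case p of (k, j) \<Rightarrow> 1 / real (Suc k) ^ (2 * n) * (1 / real (Suc j) ^ 2))"
    by (simp add: p)
qed auto

text \<open>Induction on \<open>n\<close>: dividing the previous case by \<open>u\<^sup>2\<close>
  raises the powers of \<open>u\<close> in the sum, and \<open>step\<close> splits the divided
  remainder into the new summand \<open>i = n\<close> and the next remainder.\<close>

lemma reciprocal_lattice_term_expand:
  fixes u v r :: real
  assumes "u > 0" "v > 0"
  shows "1 / (u ^ (2 * n) * (r\<^sup>2 * u\<^sup>2 + v\<^sup>2)) =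
     (\<Sum>i<n. (- r\<^sup>2) ^ i * (1 / u ^ (2 * n - 2 * i) * (1 / v ^ (2 * i + 2)))) +
     (- r\<^sup>2) ^ n * (1 / (v ^ (2 * n) * (r\<^sup>2 * u\<^sup>2 + v\<^sup>2)))"
proof (induction n)
  case 0
  show ?case by simp
next
  case (Suc n)
  define w where "w = r\<^sup>2 * u\<^sup>2 + v\<^sup>2"
  have w: "w > 0"
    using assms by (auto simp: w_def intro!: add_nonneg_pos)
  have step: "1 / w / u\<^sup>2 = 1 / u\<^sup>2 * (1 / v\<^sup>2) - r\<^sup>2 * (1 / (v\<^sup>2 * w))"
    using assms w by (simp add: divide_simps) (simp add: w_def)
  have "1 / (u ^ (2 * Suc n) * w) = 1 / (u ^ (2 * n) * w) / u\<^sup>2"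
    by (simp add: power2_eq_square mult_ac)
  also have "\<dots> = (\<Sum>i<n. (- r\<^sup>2) ^ i * (1 / u ^ (2 * n - 2 * i) * (1 / v ^ (2 * i + 2)))) / u\<^sup>2 +
     (- r\<^sup>2) ^ n * (1 / v ^ (2 * n)) * (1 / w / u\<^sup>2)"
    using Suc.IH by (simp add: w_def add_divide_distrib)
  also have "(\<Sum>i<n. (- r\<^sup>2) ^ i * (1 / u ^ (2 * n - 2 * i) * (1 / v ^ (2 * i + 2)))) / u\<^sup>2 =
     (\<Sum>i<n. (- r\<^sup>2) ^ i * (1 / u ^ (2 * Suc n - 2 * i) * (1 / v ^ (2 * i + 2))))"
    unfolding sum_divide_distrib
  proof (rule sum.cong)
    fix i assume "i \<in> {..<n}"
    hence "2 * Suc n - 2 * i = (2 * n - 2 * i) + 2" by auto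
    hence "u ^ (2 * Suc n - 2 * i) = u ^ (2 * n - 2 * i) * u\<^sup>2"
      by (simp only: power_add)
    thus "(- r\<^sup>2) ^ i * (1 / u ^ (2 * n - 2 * i) * (1 / v ^ (2 * i + 2))) / u\<^sup>2 =
        (- r\<^sup>2) ^ i * (1 / u ^ (2 * Suc n - 2 * i) * (1 / v ^ (2 * i + 2)))"
      by simp
  qed auto
  also have "(- r\<^sup>2) ^ n * (1 / v ^ (2 * n)) * (1 / w / u\<^sup>2) =
      (- r\<^sup>2) ^ n * (1 / u ^ (2 * Suc n - 2 * n) * (1 / v ^ (2 * n + 2))) +
      (- r\<^sup>2) ^ Suc n * (1 / (v ^ (2 * Suc n) * w))"
  proof -
    have "2 * Suc n - 2 * n = 2" "2 * Suc n = 2 * n + 2" by auto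
    thus ?thesis unfolding step power_add by (simp add: algebra_simps power2_eq_square)
  qed
  finally show ?case by (simp add: w_def)
qed

text \<open>The finite expansion is summed over all pairs. Each summand factors into two even zeta
  values, and the remainder is again a lattice sum, with its indices swapped.\<close>

lemma lattice_sum_reciprocity:
  assumes "n \<ge> 1" "r > 0"
  shows "lattice_sum n r =
     (\<Sum>i<n. (- r\<^sup>2) ^ i * (zeta_nat (2 * n - 2 * i) * zeta_nat (2 * i + 2))) +
     (-1) ^ n * r ^ (2 * n - 2) * lattice_sum n (1 / r)"
proof -
  define f where "f n r = (\<lambda>(k, j). 1 / (real (Suc k) ^ (2 * n) * (r\<^sup>2 * real (Suc k) ^ 2 + real (Suc j) ^ 2)))"
    for n :: nat and r :: real
  define z where "z i = (\<lambda>(k, j). 1 / real (Suc k) ^ (2 * n - 2 * i) * (1 / real (Suc j) ^ (2 * i + 2)))" for i :: nat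
  have z_sum: "(z i has_sum (zeta_nat (2 * n - 2 * i) * zeta_nat (2 * i + 2))) (UNIV \<times> UNIV)" if "i < n" for i
  proof (rule has_sum_SigmaI)
    from that have ge: "2 * n - 2 * i \<ge> 2" "2 * i + 2 \<ge> 2" by auto
    show "((\<lambda>j. z i (k, j)) has_sum 1 / real (Suc k) ^ (2 * n - 2 * i) * zeta_nat (2 * i + 2)) UNIV" for k
      unfolding z_def prod.case by (intro has_sum_cmult_right zeta_nat_has_sum ge)
    show "((\<lambda>k. 1 / real (Suc k) ^ (2 * n - 2 * i) * zeta_nat (2 * i + 2)) has_sum
        zeta_nat (2 * n - 2 * i) * zeta_nat (2 * i + 2)) UNIV"
      by (intro has_sum_cmult_left zeta_nat_has_sum ge)
    show "z i summable_on UNIV \<times> UNIV"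
      unfolding z_def using zeta_nat_has_sum[OF ge(1)] zeta_nat_has_sum[OF ge(2)]
      by (intro summable_on_product_nonneg) (auto simp: summable_on_def)
  qed
  have "((\<lambda>(k, j). f n (1 / r) (j, k)) has_sum lattice_sum n (1 / r)) (UNIV \<times> UNIV)"
    using lattice_sum_has_sum[OF assms(1), of "1 / r"] unfolding f_def
    by (subst (asm) has_sum_swap) simp
  hence "((\<lambda>p. (\<Sum>i<n. (- r\<^sup>2) ^ i * z i p) +
        (-1) ^ n * r ^ (2 * n - 2) * (case p of (k, j) \<Rightarrow> f n (1 / r) (j, k))) has_sum
      ((\<Sum>i<n. (- r\<^sup>2) ^ i * (zeta_nat (2 * n - 2 * i) * zeta_nat (2 * i + 2))) +
     (-1) ^ n * r ^ (2 * n - 2) * lattice_sum n (1 / r))) (UNIV \<times> UNIV)"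
    by (intro has_sum_add has_sum_finite_sum has_sum_cmult_right z_sum) auto
  also have "(\<lambda>p. (\<Sum>i<n. (- r\<^sup>2) ^ i * z i p) +
        (-1) ^ n * r ^ (2 * n - 2) * (case p of (k, j) \<Rightarrow> f n (1 / r) (j, k))) = f n r"
  proof
    fix p :: "nat \<times> nat"
    obtain k j where p: "p = (k, j)" by force
    define u v where "u = real (Suc k)" and "v = real (Suc j)"
    have uv: "u > 0" "v > 0" by (simp_all add: u_def v_def)
    \<comment> \<open>Taking \<open>r\<^sup>2\<close> out of the last factor of the denominator
      turns \<open>r\<close> into \<open>1 / r\<close> and lowers the exponent \<open>2 * n\<close>
      to \<open>2 * n - 2\<close>.\<close>
    have "(- r\<^sup>2) ^ n * (1 / (v ^ (2 * n) * (r\<^sup>2 * u\<^sup>2 + v\<^sup>2))) =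
        (-1) ^ n * r ^ (2 * n - 2) * (1 / (v ^ (2 * n) * ((1 / r)\<^sup>2 * v\<^sup>2 + u\<^sup>2)))"
    proof -
      have "2 * n = (2 * n - 2) + 2" using assms by simp
      hence "(r\<^sup>2) ^ n = r ^ (2 * n - 2) * r\<^sup>2"
        by (metis power_add power_mult)
      hence "(- r\<^sup>2) ^ n = (-1) ^ n * r ^ (2 * n - 2) * r\<^sup>2"
        by (subst power_minus) simp
      moreover have "r\<^sup>2 * u\<^sup>2 + v\<^sup>2 = r\<^sup>2 * ((1 / r)\<^sup>2 * v\<^sup>2 + u\<^sup>2)"
        using assms by (simp add: field_simps)
      ultimately show ?thesis using assms by simp
    qed
    with reciprocal_lattice_term_expand[OF uv, of n r]
    show "(\<Sum>i<n. (- r\<^sup>2) ^ i * z i p) +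
        (-1) ^ n * r ^ (2 * n - 2) * (case p of (k, j) \<Rightarrow> f n (1 / r) (j, k)) = f n r p"
      by (simp add: p f_def z_def u_def v_def)
  qed
  finally have "(f n r has_sum ((\<Sum>i<n. (- r\<^sup>2) ^ i * (zeta_nat (2 * n - 2 * i) * zeta_nat (2 * i + 2))) +
     (-1) ^ n * r ^ (2 * n - 2) * lattice_sum n (1 / r))) (UNIV \<times> UNIV)" .
  moreover have "(f n r has_sum lattice_sum n r) (UNIV \<times> UNIV)"
    unfolding f_def by (rule lattice_sum_has_sum[OF assms(1)])
  ultimately show ?thesis
    by (rule has_sum_unique[symmetric])
qed

text \<open>The inner sum over \<open>j\<close> is the hyperbolic cotangent expansion at
  \<open>y = r * (k+1)\<close>, divided by \<open>2 * y\<close>; its three parts contribute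
  \<open>zeta_nat (2 * n + 1)\<close>, the exponential series and
  \<open>zeta_nat (2 * n + 2)\<close>. The form with \<open>sums\<close> also yields convergence of
  the series of \<open>S_series\<close>.\<close>

lemma S_series_sums_lattice_sum:
  assumes "n \<ge> 1" "r > 0"
  shows "(\<lambda>k. 1 / (real (Suc k) ^ (2 * n + 1) * (exp (pi * (2 * r) * real (Suc k)) - 1))) sums
     (zeta_nat (2 * n + 2) / (2 * pi * r) + r / pi * lattice_sum n r - zeta_nat (2 * n + 1) / 2)"
proof -
  define g where "g k = 1 / real (Suc k) ^ (2 * n) *
     ((pi + 2 * pi / (exp (2 * pi * (r * real (Suc k))) - 1) - 1 / (r * real (Suc k))) / (2 * (r * real (Suc k))))" for k
  have inner: "((\<lambda>j. case (k, j) of (k, j) \<Rightarrow>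
      1 / (real (Suc k) ^ (2 * n) * (r\<^sup>2 * real (Suc k) ^ 2 + real (Suc j) ^ 2))) has_sum g k) UNIV" for k
  proof -
    define y where "y = r * real (Suc k)"
    have y: "y > 0" using assms by (simp add: y_def)
    have "((\<lambda>j. 2 * y / (y\<^sup>2 + real (Suc j) ^ 2)) has_sum
           (pi + 2 * pi / (exp (2 * pi * y) - 1) - 1 / y)) UNIV"
      using y by (intro sums_nonneg_imp_has_sum coth_partial_fractions) auto
    hence "((\<lambda>j. 1 / real (Suc k) ^ (2 * n) * ((2 * y / (y\<^sup>2 + real (Suc j) ^ 2)) / (2 * y))) has_sum g k) UNIV"
      unfolding g_def y_def [symmetric] by (intro has_sum_cmult_right has_sum_divide_const)
    also have "(\<lambda>j. 1 / real (Suc k) ^ (2 * n) * ((2 * y / (y\<^sup>2 + real (Suc j) ^ 2)) / (2 * y))) =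
      (\<lambda>j. case (k, j) of (k, j) \<Rightarrow>
        1 / (real (Suc k) ^ (2 * n) * (r\<^sup>2 * real (Suc k) ^ 2 + real (Suc j) ^ 2)))"
      using y assms by (simp add: y_def power_mult_distrib fun_eq_iff del: of_nat_Suc)
    finally show ?thesis .
  qed
  have "(g has_sum lattice_sum n r) UNIV"
    by (rule has_sum_SigmaD[OF lattice_sum_has_sum[OF assms(1)] inner])
  hence "g sums lattice_sum n r"
    by (rule has_sum_imp_sums)
  moreover have Z: "(\<lambda>k. 1 / real (Suc k) ^ (2 * n + 1)) sums zeta_nat (2 * n + 1)"
      "(\<lambda>k. 1 / real (Suc k) ^ (2 * n + 2)) sums zeta_nat (2 * n + 2)"
    by (rule has_sum_imp_sums, rule zeta_nat_has_sum, use assms in simp)+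
  ultimately have "(\<lambda>k. 1 / real (Suc k) ^ (2 * n + 2) / (2 * pi * r) + r / pi * g k - 1 / real (Suc k) ^ (2 * n + 1) / 2) sums
     (zeta_nat (2 * n + 2) / (2 * pi * r) + r / pi * lattice_sum n r - zeta_nat (2 * n + 1) / 2)"
    by (intro sums_add sums_diff sums_divide sums_mult)
  also have "(\<lambda>k. 1 / real (Suc k) ^ (2 * n + 2) / (2 * pi * r) + r / pi * g k - 1 / real (Suc k) ^ (2 * n + 1) / 2) =
      (\<lambda>k. 1 / (real (Suc k) ^ (2 * n + 1) * (exp (pi * (2 * r) * real (Suc k)) - 1)))"
  proof
    fix k
    define u where "u = real (Suc k)"
    define E where "E = exp (2 * pi * (r * u)) - 1"
    have u: "u > 0" by (simp add: u_def)
    have E: "E > 0" using u assms by (simp add: E_def)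
    have "1 / u ^ (2 * n + 2) / (2 * pi * r) +
        r / pi * (1 / u ^ (2 * n) * ((pi + 2 * pi / E - 1 / (r * u)) / (2 * (r * u)))) -
        1 / u ^ (2 * n + 1) / 2 = 1 / (u ^ (2 * n + 1) * E)"
      using u E assms by (simp add: divide_simps power_add power2_eq_square)
    thus "1 / real (Suc k) ^ (2 * n + 2) / (2 * pi * r) + r / pi * g k - 1 / real (Suc k) ^ (2 * n + 1) / 2 =
      1 / (real (Suc k) ^ (2 * n + 1) * (exp (pi * (2 * r) * real (Suc k)) - 1))"
      by (simp add: g_def E_def u_def mult_ac del: of_nat_Suc power_Suc)
  qed
  finally show ?thesis .
qed

text \<open>For odd \<open>n\<close> the reciprocity law says that
  \<open>lattice_sum n r + r ^ (2 * n - 2) * lattice_sum n (1 / r)\<close> is the finite sum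
  \<open>Q\<close>. On the left-hand side the two lattice sums occur in exactly this combination, so
  only even zeta values remain, to be matched with the Bernoulli sum.\<close>

theorem Ramanujan_zeta_odd:
  assumes "odd n" "r > 0"
  shows "(zeta_nat (2 * n + 1) / 2 + S_series (2 * n + 1) (2 * r)) +
         r ^ (2 * n) * (zeta_nat (2 * n + 1) / 2 + S_series (2 * n + 1) (2 / r)) =
         - ((2 * pi) ^ (2 * n + 2) / (4 * pi * r)) *
         (\<Sum>k=0..n+1. (- r\<^sup>2) ^ k *
            (bernoulli (2 * k) * bernoulli (2 * n + 2 - 2 * k) / (fact (2 * k) * fact (2 * n + 2 - 2 * k))))"
proof -
  define P where "P = (2 * pi) ^ (2 * n + 2)"
  define Q where "Q = (\<Sum>i<n. (- r\<^sup>2) ^ i * (zeta_nat (2 * n - 2 * i) * zeta_nat (2 * i + 2)))"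
  define Z where "Z = zeta_nat (2 * n + 2)"
  define b where "b k = bernoulli k / fact k" for k
  define h where "h k = (- r\<^sup>2) ^ k * (b (2 * k) * b (2 * n + 2 - 2 * k))" for k
  have n: "n \<ge> 1" using assms by (cases n) auto
  have P: "P > 0" by (simp add: P_def)
  have b0: "b 0 = 1"
    by (simp add: b_def bernoulli_0)
  have "2 * (n + 1) = 2 * n + 2" by simp
  hence "Z = (-1) ^ Suc (n + 1) * b (2 * n + 2) * P / 2"
    using zeta_nat_even[of "n + 1"] by (simp only: Z_def P_def b_def)
  hence bn: "b (2 * n + 2) = - 2 * Z / P"
    using P assms(1) by simp
  have h_mid: "h (Suc i) = - 4 * r\<^sup>2 / P * ((- r\<^sup>2) ^ i * (zeta_nat (2 * n - 2 * i) * zeta_nat (2 * i + 2)))"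
    if "i < n" for i
  proof -
    define j where "j = n - i"
    have j: "n = i + j" "j \<ge> 1" using that by (auto simp: j_def)
    have eq: "2 * n - 2 * i = 2 * j" "2 * i + 2 = 2 * Suc i" "2 * n + 2 - 2 * Suc i = 2 * j"
      using j by auto
    \<comment> \<open>The total exponent is \<open>n + 3\<close>, which is even.\<close>
    have sgn: "(-1) ^ Suc j * (-1) ^ Suc (Suc i) = (1 :: real)"
      using assms(1) unfolding j by (simp flip: power_add)
    have "zeta_nat (2 * j) * zeta_nat (2 * Suc i) =
        ((-1) ^ Suc j * (-1) ^ Suc (Suc i)) * (b (2 * Suc i) * b (2 * j)) * ((2 * pi) ^ (2 * j) * (2 * pi) ^ (2 * Suc i)) / 4"
    proof -
      have "zeta_nat (2 * l) = (-1) ^ Suc l * b (2 * l) * (2 * pi) ^ (2 * l) / 2" if "l \<ge> 1" for l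
        unfolding b_def by (rule zeta_nat_even[OF that])
      note zeta_nat_even' = this[OF j(2)] this[of "Suc i"]
      have "(s * x * p / 2) * (t * y * q / 2) = (s * t) * (y * x) * (p * q) / 4" for s t x y p q :: real
        by simp
      thus ?thesis
        by (simp only: zeta_nat_even' le_add1 Suc_le_mono One_nat_def)
    qed
    also have "(2 * pi) ^ (2 * j) * (2 * pi) ^ (2 * Suc i) = P"
      by (simp only: P_def j power_add [symmetric]) (simp add: algebra_simps)
    finally have "b (2 * Suc i) * b (2 * j) = 4 / P * (zeta_nat (2 * j) * zeta_nat (2 * Suc i))"
      using P unfolding sgn by (simp add: field_simps)
    thus ?thesis
      unfolding h_def eq by simp
  qed
  \<comment> \<open>The end terms are separated because \<open>zeta_nat_even\<close> starts at index
    1: with \<open>b 0 = 1\<close> they involve only \<open>Z\<close>, whereas the inner terms are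
    products of two zeta values and add up to a multiple of \<open>Q\<close>.\<close>
  have "(\<Sum>k=0..n+1. h k) = h 0 + (\<Sum>i<n. h (Suc i)) + h (n + 1)"
    by (simp only: atLeast0AtMost Suc_eq_plus1 [symmetric] sum.atMost_Suc sum.atMost_shift [of h n])
  also have "(\<Sum>i<n. h (Suc i)) = - 4 * r\<^sup>2 / P * Q"
    unfolding Q_def sum_distrib_left by (intro sum.cong h_mid) auto
  also have "h 0 = - 2 * Z / P"
    using bn by (simp add: h_def b0)
  also have "h (n + 1) = - 2 * Z * r ^ (2 * n + 2) / P"
  proof -
    have "(- r\<^sup>2) ^ (n + 1) = (r\<^sup>2) ^ (n + 1)"
      using assms by (intro power_minus_even) simp
    also have "\<dots> = r ^ (2 * (n + 1))"
      by (simp only: power_mult)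
    finally have "(- r\<^sup>2) ^ (n + 1) = r ^ (2 * n + 2)"
      by simp
    moreover have "2 * n + 2 - 2 * (n + 1) = 0" "2 * (n + 1) = 2 * n + 2" by simp_all
    ultimately show ?thesis
      unfolding h_def by (simp only: b0 bn) simp
  qed
  finally have H: "(\<Sum>k=0..n+1. h k) = - 2 * Z / P + (- 4 * r\<^sup>2 / P * Q) + (- 2 * Z * r ^ (2 * n + 2) / P)" .
  have L: "lattice_sum n r = Q - r ^ (2 * n - 2) * lattice_sum n (1 / r)"
    using lattice_sum_reciprocity[OF n assms(2)] assms(1) by (simp add: Q_def)
  have S: "zeta_nat (2 * n + 1) / 2 + S_series (2 * n + 1) (2 * t) = Z / (2 * pi * t) + t / pi * lattice_sum n t"
    if "t > 0" for t
    using sums_unique[OF S_series_sums_lattice_sum[OF n that]] by (simp add: S_series_def Z_def)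
  have S': "zeta_nat (2 * n + 1) / 2 + S_series (2 * n + 1) (2 / r) =
      Z / (2 * pi * (1 / r)) + (1 / r) / pi * lattice_sum n (1 / r)"
    using S[of "1 / r"] assms by simp
  have "2 * n = (2 * n - 2) + 2"
    using n by simp
  hence r2n: "r ^ (2 * n) = r ^ (2 * n - 2) * r\<^sup>2"
    by (metis power_add)
  have "(\<Sum>k=0..n+1. (- r\<^sup>2) ^ k *
      (bernoulli (2 * k) * bernoulli (2 * n + 2 - 2 * k) / (fact (2 * k) * fact (2 * n + 2 - 2 * k)))) =
      (\<Sum>k=0..n+1. h k)"
    by (simp add: h_def b_def)
  also note H
  finally have H': "- ((2 * pi) ^ (2 * n + 2) / (4 * pi * r)) * (\<Sum>k=0..n+1. (- r\<^sup>2) ^ k *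
      (bernoulli (2 * k) * bernoulli (2 * n + 2 - 2 * k) / (fact (2 * k) * fact (2 * n + 2 - 2 * k)))) =
      - (P / (4 * pi * r)) * (- 2 * Z / P + (- 4 * r\<^sup>2 / P * Q) + (- 2 * Z * r ^ (2 * n + 2) / P))"
    by (simp only: P_def)
  have r2n2: "r ^ (2 * n + 2) = r ^ (2 * n - 2) * r\<^sup>2 * r\<^sup>2"
    by (simp only: power_add r2n)
  show ?thesis
    unfolding H' S[OF assms(2)] S' L r2n r2n2
    using P assms(2) by (simp add: divide_simps) (simp add: algebra_simps power2_eq_square power4_eq_xxxx)
qed

section \<open>Elimination\<close>

lemma zeta_of_nat:
  assumes "s \<ge> 2"
  shows "zeta (of_nat s) = of_real (zeta_nat s)"
proof -
  have "summable (\<lambda>k. 1 / real (Suc k) ^ s)"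
    using has_sum_imp_sums[OF zeta_nat_has_sum[OF assms]] by (rule sums_summable)
  hence "of_real (zeta_nat s) = (\<Sum>k. complex_of_real (1 / real (Suc k) ^ s))"
    unfolding zeta_nat_def by (rule suminf_of_real)
  also have "(\<lambda>k. complex_of_real (1 / real (Suc k) ^ s)) = (\<lambda>k. 1 / of_nat (Suc k) powr of_nat s)"
    by (simp add: powr_nat fun_eq_iff del: of_nat_Suc)
  finally show ?thesis by (simp add: zeta_def)
qed

text \<open>Convergence is a by-product of the lattice sum formula at \<open>r / 2\<close>.\<close>

lemma S_series_sums:
  assumes "n \<ge> 1" "r > 0"
  shows "(\<lambda>k. 1 / (real (Suc k) ^ (2 * n + 1) * (exp (pi * r * real (Suc k)) - 1))) sums S_series (2 * n + 1) r"
  using S_series_sums_lattice_sum[of n "r / 2"] assms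
  unfolding S_series_def by (simp add: sums_iff)

lemma S_series_pos:
  assumes "n \<ge> 1" "r > 0"
  shows "S_series (2 * n + 1) r > 0"
  unfolding S_series_def using assms
  by (intro suminf_pos sums_summable[OF S_series_sums]) auto

text \<open>Termwise this is \<open>2 / (x\<^sup>2 - 1) \<le> 1 / (x - 1)\<close> for \<open>x = exp (pi * r * k) > 1\<close>.\<close>
lemma S_series_double_le:
  assumes "n \<ge> 1" "r > 0"
  shows "2 * S_series (2 * n + 1) (2 * r) \<le> S_series (2 * n + 1) r"
proof (rule sums_le)
  show "(\<lambda>k. 2 * (1 / (real (Suc k) ^ (2 * n + 1) * (exp (pi * (2 * r) * real (Suc k)) - 1)))) sums
      (2 * S_series (2 * n + 1) (2 * r))"
    using assms by (intro sums_mult S_series_sums) auto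
  show "(\<lambda>k. 1 / (real (Suc k) ^ (2 * n + 1) * (exp (pi * r * real (Suc k)) - 1))) sums
      S_series (2 * n + 1) r"
    using assms by (rule S_series_sums)
  fix k
  define x where "x = exp (pi * r * real (Suc k))"
  have x: "x > 1" using assms by (simp add: x_def)
  have "exp (pi * (2 * r) * real (Suc k)) = x * x"
    by (simp add: x_def flip: exp_add)
  moreover have "2 * (1 / (x * x - 1)) \<le> 1 / (x - 1)"
  proof -
    have "x * x - 1 = (x - 1) * (x + 1)" by (simp add: algebra_simps)
    moreover have "(x - 1) * 2 \<le> (x - 1) * (x + 1)"
      using x by (intro mult_left_mono) auto
    ultimately show ?thesis using x by (simp add: divide_simps)
  qed
  hence "1 / real (Suc k) ^ (2 * n + 1) * (2 * (1 / (x * x - 1))) \<le> 1 / real (Suc k) ^ (2 * n + 1) * (1 / (x - 1))"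
    by (intro mult_left_mono) auto
  ultimately show "2 * (1 / (real (Suc k) ^ (2 * n + 1) * (exp (pi * (2 * r) * real (Suc k)) - 1))) \<le>
      1 / (real (Suc k) ^ (2 * n + 1) * (exp (pi * r * real (Suc k)) - 1))"
    by (simp add: x_def)
qed

theorem mainTheorem2:
  fixes m :: nat
  assumes "m \<ge> 1"
  shows "zeta (of_nat (4*m-1)) = of_real (
      - (F_num (2*m-1) * 4 ^ (4*m-2) / D_num m) * S_series (4*m-1) 1
      + (G_num (2*m-1) * 4 ^ (2*m-1) / D_num m) * S_series (4*m-1) 2
      - (F_num (2*m-1) * 4 ^ (2*m-1) / D_num m) * S_series (4*m-1) 4)"
proof -
  define n where "n = 2 * m - 1"
  have n: "odd n" "n \<ge> 1" "4 * m - 1 = 2 * n + 1" "4 * m - 2 = n + n"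
    using assms by (auto simp: n_def)
  define q :: real where "q = 4 ^ n"
  have q: "q \<ge> 1" by (simp add: q_def)
  have "4 ^ (4 * m - 2) = q * q"
    unfolding n(4) q_def by (simp add: power_add)
  define F G where "F = F_num n" and "G = G_num n"
  define S where "S = S_series (2 * n + 1)"
  define z where "z = zeta_nat (2 * n + 1)"
  define D where "D = q * ((q + 1) * F - G) / 2"
  \<comment> \<open>Normalised so that the factor in Ramanujan's formula is
    \<open>2 * c / r\<close>: this is \<open>c\<close> at \<open>r = 2\<close>, and at
    \<open>r = 1\<close> the 2 cancels because both brackets on the left coincide.\<close>
  define c where "c = (2 * pi) ^ (2 * n + 2) / (8 * pi)"
  have c: "c > 0" by (simp add: c_def)
  define H where "H r = (\<Sum>k=0..n+1. (- r\<^sup>2) ^ k *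
      (bernoulli (2 * k) * bernoulli (2 * n + 2 - 2 * k) / (fact (2 * k) * fact (2 * n + 2 - 2 * k))))" for r :: real
  have H: "F = H 1" "G = H 2"
    by (simp_all only: F_def G_def F_num_def G_num_def H_def) simp_all
  have R: "(z / 2 + S (2 * r)) + r ^ (2 * n) * (z / 2 + S (2 / r)) = - (2 * c / r) * H r" if "r > 0" for r
    using Ramanujan_zeta_odd[OF n(1) that]
    by (simp only: H_def S_def z_def c_def) (simp add: mult_ac)
  have F: "z / 2 + S 2 = - c * F"
    using R[of 1] by (simp add: H)
  have G: "(z / 2 + S 4) + q * (z / 2 + S 1) = - c * G"
    using R[of 2] by (simp add: H q_def power_mult)
  have "2 * c * D = q * ((q + 1) * (c * F) - c * G)"
    by (simp add: D_def field_simps)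
  also have "\<dots> = q * ((z / 2 + S 4) + q * (z / 2 + S 1) - (q + 1) * (z / 2 + S 2))"
    unfolding F G by (simp add: algebra_simps)
  \<comment> \<open>The multiples of \<open>z\<close> cancel, so the sign of \<open>D\<close>
    depends on \<open>S\<close> alone.\<close>
  also have "\<dots> = q * (q * (S 1 - S 2) - S 2 + S 4)"
    by (simp add: algebra_simps)
  finally have cD: "2 * c * D = q * (q * (S 1 - S 2) - S 2 + S 4)" .
  have D: "D \<noteq> 0"
  proof -
    have S: "2 * S 2 \<le> S 1" "S 2 > 0" "S 4 > 0"
      using S_series_double_le[of n 1] S_series_pos[of n] n(2) by (simp_all add: S_def)
    \<comment> \<open>The doubling inequality makes \<open>S 1 - S 2\<close> at least
      \<open>S 2\<close>, and \<open>q \<ge> 1\<close> preserves this; the positive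
      \<open>S 4\<close> makes the total strictly positive.\<close>
    have "S 2 \<le> 1 * (S 1 - S 2)"
      using S by simp
    also have "\<dots> \<le> q * (S 1 - S 2)"
      using q S by (intro mult_right_mono) auto
    finally have "q * (S 1 - S 2) - S 2 + S 4 > 0"
      using S(3) by (simp only: add_nonneg_pos diff_ge_0_iff_ge)
    with cD q c show ?thesis by auto
  qed
  have "2 * c * (z * D) = z * (2 * c * D)"
    by simp
  \<comment> \<open>The terms are regrouped into the left-hand sides of \<open>F\<close> and
    \<open>G\<close>; the products of two values of \<open>S\<close> cancel. Substituting
    Ramanujan's formula then leaves the common factor \<open>2 * c\<close>.\<close>
  also have "\<dots> = 2 * q * ((z / 2 + S 2) * (q * S 1) - ((z / 2 + S 4) + q * (z / 2 + S 1)) * S 2 + (z / 2 + S 2) * S 4)"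
    unfolding cD by (simp add: algebra_simps)
  also have "\<dots> = 2 * c * (- (F * (q * q)) * S 1 + G * q * S 2 - F * q * S 4)"
    unfolding F G by (simp add: algebra_simps)
  finally have "z * D = - (F * (q * q)) * S 1 + G * q * S 2 - F * q * S 4"
    using c by simp
  hence "z = (- (F * (q * q)) * S 1 + G * q * S 2 - F * q * S 4) / D"
    using D by (simp add: eq_divide_eq)
  hence "z = - (F * (q * q) / D) * S 1 + (G * q / D) * S 2 - (F * q / D) * S 4"
    by (simp add: add_divide_distrib diff_divide_distrib)
  moreover have "D_num m = D"
    by (simp add: D_num_def D_def F_def G_def q_def n_def)
  moreover have "zeta (of_nat (4 * m - 1)) = of_real z"
    unfolding n(3) z_def using n(2) by (intro zeta_of_nat) auto
  ultimately show ?thesis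
    using \<open>4 ^ (4 * m - 2) = q * q\<close>
    by (simp only: F_def G_def S_def q_def n(3) n_def [symmetric])
qed

end
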